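(* Let $X$ and $Y$ be finitely-supported random variables with joint distribution $P_{XY}$. There exist a random variable $Z$ and a finitely-supported joint distribution $Q_{XYZ}$ of $(X,Y,Z)$ satisfying consistency, informativeness, and perfect secrecy if and only if $$\sum_{x \in \operatorname{supp} X} P_{Y\mid X}(y \mid x) \le 1 \quad \text{for all } y \in \operatorname{supp} Y.$$
   Context: $P_X$ and $P_Y$ denote the marginals of $P_{XY}$; $\operatorname{supp} X = \{x : P_X(x)>0\}$ and $\operatorname{supp} Y = \{y : P_Y(y)>0\}$ are finite sets. For $x \in \operatorname{supp} X$, $P_{Y\mid X}(y\mid x) = P_{XY}(x,y)/P_X(x)$. For a finitely-supported joint distribution $Q_{XYZ}$ (a probability distribution on triples $(x,y,z)$), $Q_{XY}$, $Q_{YZ}$, $Q_Z$, etc. denote its marginals and $Q_{X\mid YZ}$, $Q_{X\mid Z}$ its conditionals. Consistency: $Q_{XYZ}$ satisfies consistency if $Q_{XY} = P_{XY}$. Informativeness: $Q_{XYZ}$ satisfies informativeness if the conditional distribution $Q_{X\mid YZ}(\,\cdot \mid y,z)$ is degenerate (i.e. a point mass) whenever $Q_{YZ}(y,z)>0$. Perfect secrecy: $Q_{XYZ}$ satisfies perfect secrecy if $Q_{X\mid Z} = P_X$, i.e. $Q_{X\mid Z}(\,\cdot\mid z) = P_X(\cdot)$ for every $z$ with $Q_Z(z)>0$. *)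

theory Defs
  imports "HOL-Probability.Probability_Mass_Function"
begin

(* Distribution of f given g = b, with f, g random variables on the discrete space p.
   As for cond_pmf, its value is meaningful only if g = b has positive probability. *)
definition cond_dist :: "'w pmf \<Rightarrow> ('w \<Rightarrow> 'a) \<Rightarrow> ('w \<Rightarrow> 'b) \<Rightarrow> 'b \<Rightarrow> 'a pmf" where
  "cond_dist p f g b = map_pmf f (cond_pmf p {w. g w = b})"

lemma pmf_cond_dist:
  assumes "b \<in> set_pmf (map_pmf g p)"
  shows "pmf (cond_dist p f g b) a =
    pmf (map_pmf (\<lambda>w. (f w, g w)) p) (a, b) / pmf (map_pmf g p) b"
proof -
  have ne: "set_pmf p \<inter> {w. g w = b} \<noteq> {}"
    using assms by auto
  have "pmf (cond_dist p f g b) a =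
      measure_pmf.prob (cond_pmf p {w. g w = b}) {w. f w = a}"
    by (simp add: cond_dist_def pmf_map vimage_def)
  also have "\<dots> = measure_pmf.prob p {w. f w = a \<and> g w = b} / measure_pmf.prob p {w. g w = b}"
  proof -
    have pos: "emeasure (measure_pmf p) {w. g w = b} \<noteq> 0"
      using ne by (simp add: measure_pmf.emeasure_eq_measure measure_measure_pmf_not_zero)
    have "measure_pmf.prob (cond_pmf p {w. g w = b}) {w. f w = a} =
        measure (uniform_measure (measure_pmf p) {w. g w = b}) {w. f w = a}"
      by (simp add: cond_pmf.rep_eq[OF ne])
    also have "\<dots> = measure_pmf.prob p ({w. g w = b} \<inter> {w. f w = a}) / measure_pmf.prob p {w. g w = b}"
      using pos by (intro measure_uniform_measure) simp_all
    finally show ?thesis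
      by (simp add: Int_def conj_commute)
  qed
  finally show ?thesis
    by (simp add: pmf_map vimage_def)
qed

lemma pmf_cond_dist_snd_fst:
  assumes "x \<in> set_pmf (map_pmf fst P)"
  shows "pmf (cond_dist P snd fst x) y = pmf P (x, y) / pmf (map_pmf fst P) x"
proof -
  have "pmf (map_pmf (\<lambda>w. (snd w, fst w)) P) (y, x) = pmf P (x, y)"
    using pmf_map_inj'[of "\<lambda>w. (snd w, fst w)" P "(x, y)"] by (simp add: inj_def prod_eq_iff)
  then show ?thesis
    using pmf_cond_dist[OF assms, of snd y] by simp
qed

definition consistent :: "('x \<times> 'y) pmf \<Rightarrow> ('x \<times> 'y \<times> 'z) pmf \<Rightarrow> bool" where
  "consistent P Q \<longleftrightarrow> map_pmf (\<lambda>(x, y, z). (x, y)) Q = P"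

definition informative :: "('x \<times> 'y \<times> 'z) pmf \<Rightarrow> bool" where
  "informative Q \<longleftrightarrow>
     (\<forall>(y, z) \<in> set_pmf (map_pmf (\<lambda>(x, y, z). (y, z)) Q).
        \<exists>x. cond_dist Q (\<lambda>(x, y, z). x) (\<lambda>(x, y, z). (y, z)) (y, z) = return_pmf x)"

definition perfectly_secret :: "('x \<times> 'y) pmf \<Rightarrow> ('x \<times> 'y \<times> 'z) pmf \<Rightarrow> bool" where
  "perfectly_secret P Q \<longleftrightarrow>
     (\<forall>z \<in> set_pmf (map_pmf (\<lambda>(x, y, z). z) Q).
        cond_dist Q (\<lambda>(x, y, z). x) (\<lambda>(x, y, z). z) z = map_pmf fst P)"

definition secret_encoding :: "('x \<times> 'y) pmf \<Rightarrow> ('x \<times> 'y \<times> 'z) pmf \<Rightarrow> bool" where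
  "secret_encoding P Q \<longleftrightarrow>
     finite (set_pmf Q) \<and> consistent P Q \<and> informative Q \<and> perfectly_secret P Q"

(* The alphabet of Z is part of what the theorem asserts to exist, but HOL cannot quantify
   existentially over types inside a formula. "There are an alphabet and a Q over it" is
   therefore spelled out as follows in the theorem: in the equivalence the alphabet is nat
   (every finitely supported Z can be relabelled by natural numbers), and necessity is
   asserted in addition for an arbitrary alphabet type 'z. *)

end

theory Submission
  imports Defs
begin

text \<open>
  Necessity: by informativeness at most one \<open>x\<close> has \<open>Q (x, y, z) > 0\<close> for given \<open>(y, z)\<close>, and by
  secrecy \<open>Q (x, y, z) \<le> P\<^sub>X x * Q\<^sub>Z z\<close>. Hence the sum over \<open>x\<close> of \<open>Q (x, y, z) / P\<^sub>X x\<close> is at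
  most \<open>Q\<^sub>Z z\<close>; sum over \<open>z\<close>.

  Sufficiency: the stochastic matrix \<open>P\<^sub>Y\<^sub>|\<^sub>X\<close> has column sums at most 1, so by a rectangular version
  of Birkhoff's theorem it is a convex combination of the matrices of injections \<open>f\<^sub>i\<close> from
  \<open>supp X\<close> to \<open>supp Y\<close>. Draw the index \<open>Z = i\<close> with the weights of this combination,
  independently of \<open>X\<close>, and let \<open>Y = f\<^sub>i X\<close>.
\<close>

section \<open>Hall's theorem\<close>

text \<open>Rado's argument: from a set with two elements one of them can be removed without violating
  Hall's condition, by submodularity of the cardinality.\<close>

lemma hall_marriage:
  fixes N :: "'a \<Rightarrow> 'b set"
  assumes "finite A"
    and "\<And>a. a \<in> A \<Longrightarrow> finite (N a)"
    and "\<And>S. S \<subseteq> A \<Longrightarrow> card S \<le> card (\<Union>(N ` S))"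
  shows "\<exists>f. inj_on f A \<and> (\<forall>a\<in>A. f a \<in> N a)"
  using assms(2,3)
\<comment> \<open>The measure is the total size of the sets, so deleting one element from one
  \<open>N a\<close> already permits the induction hypothesis.\<close>
proof (induction "\<Sum>a\<in>A. card (N a)" arbitrary: N rule: less_induct)
  case less
  note fin = less.prems(1) and hall = less.prems(2)
  show ?case
  proof (cases "\<exists>a\<in>A. card (N a) \<ge> 2")
    \<comment> \<open>Hall's condition on singletons leaves exactly one element in each
      \<open>N a\<close>; on pairs it makes these elements distinct.\<close>
    case False
    have "\<exists>b. N a = {b}" if "a \<in> A" for a
    proof -
      have "card (N a) = 1"
        using hall[of "{a}"] False that by force
      then show ?thesis by (simp add: card_1_singleton_iff)
    qed
    then obtain f where f: "\<And>a. a \<in> A \<Longrightarrow> N a = {f a}" by metis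
    have "inj_on f A"
    proof (rule inj_onI, rule ccontr)
      fix a b assume ab: "a \<in> A" "b \<in> A" "f a = f b" "a \<noteq> b"
      then have "\<Union>(N ` {a, b}) = {f a}" using f by auto
      then show False using hall[of "{a, b}"] ab by simp
    qed
    then show ?thesis using f by auto
  next
    case True
    then obtain a where a: "a \<in> A" "card (N a) \<ge> 2" by blast
    then obtain x y where xy: "x \<in> N a" "y \<in> N a" "x \<noteq> y"
      by (metis card_2_iff' obtain_subset_with_card_n subset_iff)
    define R where "R = (\<lambda>v. N(a := N a - {v}))"
    have R_sub: "R v b \<subseteq> N b" for v b by (auto simp: R_def)
    have step: "\<exists>f. inj_on f A \<and> (\<forall>b\<in>A. f b \<in> N b)"
      if v: "v \<in> N a" and h: "\<And>S. S \<subseteq> A \<Longrightarrow> card S \<le> card (\<Union>(R v ` S))" for v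
    proof -
      have "(\<Sum>b\<in>A. card (R v b)) < (\<Sum>b\<in>A. card (N b))"
      proof (rule sum_strict_mono_ex1[OF assms(1)])
        show "\<forall>b\<in>A. card (R v b) \<le> card (N b)"
          using R_sub fin by (intro ballI card_mono)
        show "\<exists>b\<in>A. card (R v b) < card (N b)"
          using card_Diff1_less[OF fin[OF a(1)] v] a(1) by (auto simp: R_def)
      qed
      moreover have "finite (R v b)" if "b \<in> A" for b
        using fin[OF that] R_sub by (rule rev_finite_subset)
      ultimately obtain f where "inj_on f A" "\<forall>b\<in>A. f b \<in> R v b"
        using less.hyps[of "R v"] h by blast
      then show ?thesis using R_sub by blast
    qed
    \<comment> \<open>A violating \<open>S\<close> must contain \<open>a\<close>, since only
      \<open>N a\<close> was changed. The witness is \<open>S - {a}\<close>; being one element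
      smaller, it turns the strict inequality into \<le>.\<close>
    have viol: "\<exists>I. I \<subseteq> A - {a} \<and> card (\<Union>(N ` I) \<union> (N a - {v})) \<le> card I"
      if violated: "\<not> (\<forall>S\<subseteq>A. card S \<le> card (\<Union>(R v ` S)))" for v
    proof -
      obtain S where S: "S \<subseteq> A" "card (\<Union>(R v ` S)) < card S"
        using violated by (auto simp: not_le)
      have aS: "a \<in> S"
      proof (rule ccontr)
        assume "a \<notin> S"
        then have "R v ` S = N ` S" by (auto simp: R_def)
        then show False using S hall[of S] by simp
      qed
      have "\<Union>(R v ` S) = \<Union>(N ` (S - {a})) \<union> (N a - {v})"
        using aS by (auto simp: R_def split: if_splits)
      moreover have "card S = Suc (card (S - {a}))"
        using aS S(1) assms(1) by (metis card_Suc_Diff1 finite_subset)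
      ultimately show ?thesis using S by (intro exI[of _ "S - {a}"]) auto
    qed
    have "\<exists>v\<in>{x, y}. \<forall>S\<subseteq>A. card S \<le> card (\<Union>(R v ` S))"
    proof (rule ccontr)
      assume "\<not> ?thesis"
      then obtain I J where I: "I \<subseteq> A - {a}" "card (\<Union>(N ` I) \<union> (N a - {x})) \<le> card I"
        and J: "J \<subseteq> A - {a}" "card (\<Union>(N ` J) \<union> (N a - {y})) \<le> card J"
        using viol[of x] viol[of y] by auto
      define U where "U = \<Union>(N ` I) \<union> (N a - {x})"
      define V where "V = \<Union>(N ` J) \<union> (N a - {y})"
      have finIJ: "finite I" "finite J"
        using I(1) J(1) assms(1) by (auto intro: finite_subset)
      have finUV: "finite U" "finite V"
        using finIJ fin a I J by (auto simp: U_def V_def)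
      \<comment> \<open>Since \<open>x \<noteq> y\<close>, \<open>U \<union> V\<close> contains all
        of \<open>N a\<close>, so Hall's condition applies to \<open>insert a (I \<union> J)\<close>
        and gains 1. With the bound for \<open>I \<inter> J\<close> this gives
        \<open>card U + card V \<ge> card I + card J + 1\<close>, contrary to the choice of
        \<open>I\<close> and \<open>J\<close>.\<close>
      have "Suc (card (I \<union> J)) = card (insert a (I \<union> J))"
        using I J finIJ by (subst card_insert_disjoint) auto
      also have "\<dots> \<le> card (\<Union>(N ` insert a (I \<union> J)))"
        using I J a by (intro hall) auto
      also have "\<dots> \<le> card (U \<union> V)"
        using xy finUV by (intro card_mono) (auto simp: U_def V_def)
      finally have 1: "Suc (card (I \<union> J)) \<le> card (U \<union> V)" .
      have "card (I \<inter> J) \<le> card (\<Union>(N ` (I \<inter> J)))"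
        using I by (intro hall) auto
      also have "\<dots> \<le> card (U \<inter> V)"
        using finUV by (intro card_mono) (auto simp: U_def V_def)
      finally have 2: "card (I \<inter> J) \<le> card (U \<inter> V)" .
      show False
        using 1 2 I(2) J(2) card_Un_Int[OF finUV] card_Un_Int[OF finIJ]
        by (simp add: U_def V_def)
    qed
    then show ?thesis using step xy by blast
  qed
qed

section \<open>Birkhoff's theorem\<close>

text \<open>Double counting yields Hall's condition for the positive entries: the rows in
  \<open>S\<close> carry mass \<open>s * card S\<close>, all of it in the neighbouring columns,
  which hold only \<open>s\<close> each. Counting the whole mass both ways gives
  \<open>card A = card B\<close>, so the injection is onto.\<close>

lemma positive_transversal:
  fixes M :: "'a \<Rightarrow> 'b \<Rightarrow> real"
  assumes "finite A" "finite B"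
    and nonneg: "\<And>a b. a \<in> A \<Longrightarrow> b \<in> B \<Longrightarrow> 0 \<le> M a b"
    and row: "\<And>a. a \<in> A \<Longrightarrow> (\<Sum>b\<in>B. M a b) = s"
    and col: "\<And>b. b \<in> B \<Longrightarrow> (\<Sum>a\<in>A. M a b) = s"
    and "s > 0"
  shows "\<exists>f. bij_betw f A B \<and> (\<forall>a\<in>A. 0 < M a (f a))"
proof -
  define N where "N a = {b \<in> B. 0 < M a b}" for a
  have "card S \<le> card (\<Union>(N ` S))" if "S \<subseteq> A" for S
  proof -
    let ?T = "\<Union>(N ` S)"
    have T: "?T \<subseteq> B" by (auto simp: N_def)
    have "s * card S = (\<Sum>a\<in>S. \<Sum>b\<in>B. M a b)"
      using that row by (simp add: subset_iff)
    also have "\<dots> = (\<Sum>a\<in>S. \<Sum>b\<in>?T. M a b)"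
    proof (rule sum.cong[OF refl])
      fix a assume "a \<in> S"
      then have "\<forall>b\<in>B - ?T. M a b = 0"
        using nonneg[of a] \<open>S \<subseteq> A\<close> by (force simp: N_def)
      then show "(\<Sum>b\<in>B. M a b) = (\<Sum>b\<in>?T. M a b)"
        by (intro sum.mono_neutral_right assms(2) T)
    qed
    also have "\<dots> = (\<Sum>b\<in>?T. \<Sum>a\<in>S. M a b)" by (rule sum.swap)
    also have "\<dots> \<le> (\<Sum>b\<in>?T. \<Sum>a\<in>A. M a b)"
      using T nonneg assms(1) that by (intro sum_mono sum_mono2) auto
    also have "\<dots> = s * card ?T"
      using T col by (simp add: subset_iff)
    finally show ?thesis using \<open>s > 0\<close> by simp
  qed
  then obtain f where f: "inj_on f A" "\<forall>a\<in>A. f a \<in> N a"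
    using hall_marriage[of A N] assms(1,2) by (auto simp: N_def)
  have "s * card A = (\<Sum>a\<in>A. \<Sum>b\<in>B. M a b)" using row by simp
  also have "\<dots> = (\<Sum>b\<in>B. \<Sum>a\<in>A. M a b)" by (rule sum.swap)
  also have "\<dots> = s * card B" using col by simp
  finally have "card A = card B" using \<open>s > 0\<close> by simp
  moreover have "f ` A \<subseteq> B" using f by (auto simp: N_def)
  ultimately have "f ` A = B"
    using f(1) assms(2) by (intro card_subset_eq) (auto simp: card_image)
  then show ?thesis using f by (auto simp: bij_betw_def N_def)
qed

text \<open>Subtracting a multiple of a positive transversal keeps all row and column sums equal, so
  the induction can run on the number of positive entries. The common sum \<open>s\<close> is
  arbitrary because each subtraction lowers it.\<close>

lemma birkhoff:
  fixes M :: "'a \<Rightarrow> 'b \<Rightarrow> real"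
  assumes "finite A" "finite B"
    and "\<And>a b. a \<in> A \<Longrightarrow> b \<in> B \<Longrightarrow> 0 \<le> M a b"
    and "\<And>a. a \<in> A \<Longrightarrow> (\<Sum>b\<in>B. M a b) = s"
    and "\<And>b. b \<in> B \<Longrightarrow> (\<Sum>a\<in>A. M a b) = s"
  shows "\<exists>(n::nat) w f. (\<forall>i<n. 0 < w i \<and> bij_betw (f i) A B) \<and>
           (\<forall>a\<in>A. \<forall>b\<in>B. M a b = (\<Sum>i<n. if f i a = b then w i else 0))"
  using assms(3-)
proof (induction "card {(a, b) \<in> A \<times> B. 0 < M a b}" arbitrary: M s rule: less_induct)
  case less
  note nonneg = less.prems(1) and row = less.prems(2) and col = less.prems(3)
  show ?case
  proof (cases "A \<noteq> {} \<and> 0 < s")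
    case False
    have "M a b = 0" if "a \<in> A" "b \<in> B" for a b
    proof -
      \<comment> \<open>Here \<open>A\<close> is nonempty, so \<open>s \<le> 0\<close>, while
        \<open>s\<close> is also a sum of nonnegative entries. Hence \<open>M\<close> vanishes and
        the empty combination represents it.\<close>
      have "s = 0" using False that row[of a] nonneg sum_nonneg[of B "M a"] by fastforce
      then show ?thesis
        using that row[of a] nonneg assms(2) by (simp add: sum_nonneg_eq_0_iff)
    qed
    then show ?thesis by (intro exI[of _ 0]) simp
  next
    case True
    then obtain g where g: "bij_betw g A B" "\<And>a. a \<in> A \<Longrightarrow> 0 < M a (g a)"
      using positive_transversal[OF assms(1,2) nonneg row col] by auto
    have gB: "g a \<in> B" if "a \<in> A" for a using g(1) that by (auto simp: bij_betw_def)
    \<comment> \<open>The largest weight that keeps all entries nonnegative; it annihilates the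
      entry at the minimiser \<open>a0\<close>, so the number of positive entries drops.\<close>
    define t where "t = Min ((\<lambda>a. M a (g a)) ` A)"
    have t_le: "t \<le> M a (g a)" if "a \<in> A" for a
      using that assms(1) by (auto simp: t_def)
    have "t \<in> (\<lambda>a. M a (g a)) ` A"
      unfolding t_def using assms(1) True by (intro Min_in) auto
    then obtain a0 where a0: "a0 \<in> A" "t = M a0 (g a0)" by auto
    have "t > 0" using a0 g(2) by simp
    define M' where "M' a b = M a b - (if g a = b then t else 0)" for a b
    have M'_le: "M' a b \<le> M a b" for a b using \<open>t > 0\<close> by (simp add: M'_def)
    have "card {(a, b) \<in> A \<times> B. 0 < M' a b} < card {(a, b) \<in> A \<times> B. 0 < M a b}"
    proof (rule psubset_card_mono)
      show "finite {(a, b) \<in> A \<times> B. 0 < M a b}"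
        by (rule finite_subset[of _ "A \<times> B"]) (use assms in auto)
      have "{(a, b) \<in> A \<times> B. 0 < M' a b} \<subseteq> {(a, b) \<in> A \<times> B. 0 < M a b}"
        using M'_le by (auto intro: less_le_trans)
      moreover have "(a0, g a0) \<in> {(a, b) \<in> A \<times> B. 0 < M a b}"
        using a0 g(2) gB by auto
      moreover have "(a0, g a0) \<notin> {(a, b) \<in> A \<times> B. 0 < M' a b}"
        using a0 by (simp add: M'_def)
      ultimately show "{(a, b) \<in> A \<times> B. 0 < M' a b} \<subset> {(a, b) \<in> A \<times> B. 0 < M a b}"
        by blast
    qed
    moreover have "0 \<le> M' a b" if "a \<in> A" "b \<in> B" for a b
      using nonneg t_le that by (auto simp: M'_def)
    moreover have "(\<Sum>b\<in>B. M' a b) = s - t" if "a \<in> A" for a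
      using row[OF that] gB[OF that] assms(2) by (simp add: M'_def sum_subtractf)
    moreover have "(\<Sum>a\<in>A. M' a b) = s - t" if b: "b \<in> B" for b
    proof -
      obtain c where c: "c \<in> A" "g c = b" using b g(1) by (auto simp: bij_betw_def)
      \<comment> \<open>By injectivity of \<open>g\<close>, column \<open>b\<close> meets the
        transversal only in row \<open>c\<close> and loses exactly \<open>t\<close>.\<close>
      have "(\<Sum>a\<in>A. if g a = b then t else 0) = (\<Sum>a\<in>A. if a = c then t else 0)"
        using c g(1) by (intro sum.cong) (auto simp: bij_betw_def inj_on_def)
      then show ?thesis
        using col[OF b] c assms(1) by (simp add: M'_def sum_subtractf)
    qed
    ultimately obtain n :: nat and w f where
      IH: "\<forall>i<n. 0 < w i \<and> bij_betw (f i) A B"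
        "\<forall>a\<in>A. \<forall>b\<in>B. M' a b = (\<Sum>i<n. if f i a = b then w i else 0)"
      using less.hyps[of M' "s - t"] by blast
    have "M a b = (\<Sum>i<Suc n. if (f(n := g)) i a = b then (w(n := t)) i else 0)"
      if "a \<in> A" "b \<in> B" for a b
    proof -
      have "M a b = M' a b + (if g a = b then t else 0)" by (simp add: M'_def)
      also have "M' a b = (\<Sum>i<n. if (f(n := g)) i a = b then (w(n := t)) i else 0)"
        using IH(2) that by (auto intro!: sum.cong)
      finally show ?thesis by simp
    qed
    then show ?thesis
      using IH(1) g(1) \<open>t > 0\<close>
      by (intro exI[of _ "Suc n"] exI[of _ "w(n := t)"] exI[of _ "f(n := g)"])
        (auto simp: less_Suc_eq)
  qed
qed

text \<open>The block matrix \<open>[[M, 0], [D, M\<^sup>T]]\<close>, with \<open>D\<close> diagonal and carrying the missing column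
  sums of \<open>M\<close>, is doubly stochastic up to scaling. Because of the zero block, the bijections
  in its decomposition restrict to injections from \<open>A\<close> to \<open>B\<close>.\<close>

lemma birkhoff_rectangular:
  fixes M :: "'a \<Rightarrow> 'b \<Rightarrow> real"
  assumes "finite A" "finite B"
    and nonneg: "\<And>a b. a \<in> A \<Longrightarrow> b \<in> B \<Longrightarrow> 0 \<le> M a b"
    and row: "\<And>a. a \<in> A \<Longrightarrow> (\<Sum>b\<in>B. M a b) = s"
    and col: "\<And>b. b \<in> B \<Longrightarrow> (\<Sum>a\<in>A. M a b) \<le> s"
  shows "\<exists>(n::nat) w f. (\<forall>i<n. 0 < w i \<and> inj_on (f i) A \<and> f i ` A \<subseteq> B) \<and>
           (\<forall>a\<in>A. \<forall>b\<in>B. M a b = (\<Sum>i<n. if f i a = b then w i else 0))"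
proof -
  define D where "D b = s - (\<Sum>a\<in>A. M a b)" for b
  define K where "K u v = (case u of
      Inl a \<Rightarrow> (case v of Inl b \<Rightarrow> M a b | Inr _ \<Rightarrow> 0)
    | Inr b \<Rightarrow> (case v of Inl b' \<Rightarrow> if b = b' then D b else 0 | Inr a \<Rightarrow> M a b))"
    for u :: "'a + 'b" and v :: "'b + 'a"
  \<comment> \<open>The hypothesis \<open>col\<close> makes the diagonal entries \<open>D b\<close>
    nonnegative. Lines meeting the diagonal block sum to \<open>s\<close> by the choice of
    \<open>D\<close>, the others by \<open>row\<close>.\<close>
  have "0 \<le> K u v" if "u \<in> A <+> B" "v \<in> B <+> A" for u v
    using that nonneg col by (auto simp: K_def D_def)
  moreover have "(\<Sum>v\<in>B <+> A. K u v) = s" if "u \<in> A <+> B" for u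
    using that row assms(1,2) by (auto simp: K_def D_def sum.Plus)
  moreover have "(\<Sum>u\<in>A <+> B. K u v) = s" if "v \<in> B <+> A" for v
    using that row assms(1,2) by (auto simp: K_def D_def sum.Plus)
  ultimately have "\<exists>(n::nat) w f. (\<forall>i<n. 0 < w i \<and> bij_betw (f i) (A <+> B) (B <+> A)) \<and>
      (\<forall>u\<in>A <+> B. \<forall>v\<in>B <+> A. K u v = (\<Sum>i<n. if f i u = v then w i else 0))"
    using assms(1,2) by (intro birkhoff finite_Plus)
  then obtain n :: nat and w f where
    wf: "\<forall>i<n. 0 < w i \<and> bij_betw (f i) (A <+> B) (B <+> A)"
    and K': "\<forall>u\<in>A <+> B. \<forall>v\<in>B <+> A. K u v = (\<Sum>i<n. if f i u = v then w i else 0)"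
    by blast
  have w: "0 < w i" and f: "bij_betw (f i) (A <+> B) (B <+> A)" if "i < n" for i
    using wf that by auto
  have K: "K u v = (\<Sum>i<n. if f i u = v then w i else 0)"
    if "u \<in> A <+> B" "v \<in> B <+> A" for u v
    using K' that by blast
  define g where "g i a = projl (f i (Inl a))" for i a
  have g: "g i a \<in> B \<and> f i (Inl a) = Inl (g i a)" if "i < n" "a \<in> A" for i a
  proof -
    have "f i (Inl a) \<in> B <+> A" using f[OF that(1)] that(2) by (auto simp: bij_betw_def)
    \<comment> \<open>An index sending \<open>Inl a\<close> into the zero block would contribute its
      positive weight to an entry equal to 0.\<close>
    moreover have False if c: "c \<in> A" "f i (Inl a) = Inr c" for c
    proof -
      have "(\<Sum>j<n. if f j (Inl a) = Inr c then w j else 0) = 0"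
        using K[of "Inl a" "Inr c"] c \<open>a \<in> A\<close> by (simp add: K_def InlI InrI)
      then have "\<forall>j\<in>{..<n}. (if f j (Inl a) = Inr c then w j else 0) = 0"
        using w by (subst (asm) sum_nonneg_eq_0_iff) (auto intro: less_imp_le)
      then show False using c w[OF \<open>i < n\<close>] \<open>i < n\<close> by force
    qed
    ultimately show ?thesis by (auto simp: g_def)
  qed
  have "inj_on (g i) A" if "i < n" for i
  proof (rule inj_onI)
    fix a b assume ab: "a \<in> A" "b \<in> A" "g i a = g i b"
    then have "f i (Inl a) = f i (Inl b)" using g[OF that] by metis
    then show "a = b"
      using f[OF that] ab by (auto simp: bij_betw_def dest: inj_onD)
  qed
  moreover have "M a b = (\<Sum>i<n. if g i a = b then w i else 0)" if "a \<in> A" "b \<in> B" for a b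
  proof -
    have "M a b = (\<Sum>i<n. if f i (Inl a) = Inl b then w i else 0)"
      using K[of "Inl a" "Inl b"] that by (simp add: K_def InlI)
    also have "\<dots> = (\<Sum>i<n. if g i a = b then w i else 0)"
      using g that by (intro sum.cong) auto
    finally show ?thesis .
  qed
  ultimately show ?thesis using w g by blast
qed

text \<open>The decomposition read probabilistically: the weights are the law of a random index. A
  single index law serves all rows, which later allows \<open>Z\<close> to be independent of
  \<open>X\<close>.\<close>

corollary pmf_mixture_of_injections:
  fixes M :: "'a \<Rightarrow> 'b pmf"
  assumes "finite A" "A \<noteq> {}" "finite B"
    and supp: "\<And>a. a \<in> A \<Longrightarrow> set_pmf (M a) \<subseteq> B"
    and col: "\<And>b. b \<in> B \<Longrightarrow> (\<Sum>a\<in>A. pmf (M a) b) \<le> 1"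
  shows "\<exists>(W :: nat pmf) f. finite (set_pmf W) \<and> (\<forall>i\<in>set_pmf W. inj_on (f i) A) \<and>
           (\<forall>a\<in>A. M a = map_pmf (\<lambda>i. f i a) W)"
proof -
  have row: "(\<Sum>b\<in>B. pmf (M a) b) = 1" if "a \<in> A" for a
    using that assms by (intro sum_pmf_eq_1) auto
  have "\<exists>(n::nat) w f. (\<forall>i<n. 0 < w i \<and> inj_on (f i) A \<and> f i ` A \<subseteq> B) \<and>
      (\<forall>a\<in>A. \<forall>b\<in>B. pmf (M a) b = (\<Sum>i<n. if f i a = b then w i else 0))"
    by (intro birkhoff_rectangular[where s = 1] assms(1,3) row col pmf_nonneg)
  then obtain n :: nat and w f where
    wf: "\<forall>i<n. 0 < w i \<and> inj_on (f i) A \<and> f i ` A \<subseteq> B"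
    and eq': "\<forall>a\<in>A. \<forall>b\<in>B. pmf (M a) b = (\<Sum>i<n. if f i a = b then w i else 0)"
    by blast
  have w: "0 < w i" and inj: "inj_on (f i) A" if "i < n" for i
    using wf that by auto
  have fB: "f i a \<in> B" if "i < n" "a \<in> A" for i a
    using wf that by blast
  have eq: "pmf (M a) b = (\<Sum>i<n. if f i a = b then w i else 0)" if "a \<in> A" "b \<in> B" for a b
    using eq' that by blast
  obtain a where a: "a \<in> A" using assms(2) by blast
  \<comment> \<open>Any one row determines the total weight: each \<open>f i a\<close> lies in
    \<open>B\<close>, so each weight is counted once.\<close>
  have "1 = (\<Sum>b\<in>B. \<Sum>i<n. if f i a = b then w i else 0)"
    using row[OF a] eq[OF a] by simp
  also have "\<dots> = (\<Sum>i<n. w i)"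
    using fB[OF _ a] assms(3) by (subst sum.swap) simp
  finally have sum_w: "(\<Sum>i<n. w i) = 1" by simp
  \<comment> \<open>Nothing is known about \<open>w\<close> from \<open>n\<close> on, so the weights
    are cut off there.\<close>
  define v where "v i = (if i < n then w i else 0)" for i
  have v_nonneg: "0 \<le> v i" for i using w by (auto simp: v_def intro: less_imp_le)
  have "(\<integral>\<^sup>+i. ennreal (v i) \<partial>count_space UNIV) = (\<Sum>i<n. ennreal (v i))"
    by (rule nn_integral_count_space'[of "{..<n}"]) (auto simp: v_def)
  also have "\<dots> = ennreal (\<Sum>i<n. v i)"
    using v_nonneg by (simp add: sum_ennreal)
  also have "(\<Sum>i<n. v i) = 1" using sum_w by (simp add: v_def)
  finally have v1: "(\<integral>\<^sup>+i. ennreal (v i) \<partial>count_space UNIV) = 1" by simp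
  define W where "W = embed_pmf v"
  have W: "pmf W i = v i" for i
    unfolding W_def using v_nonneg v1 by (rule pmf_embed_pmf)
  have supp_W: "set_pmf W \<subseteq> {..<n}"
    by (auto simp: set_pmf_iff W v_def split: if_splits)
  have fin_W: "finite (set_pmf W)" using supp_W by (rule finite_subset) simp
  have "M a = map_pmf (\<lambda>i. f i a) W" if a: "a \<in> A" for a
  proof (rule pmf_eqI)
    fix b
    have "pmf (map_pmf (\<lambda>i. f i a) W) b = measure_pmf.prob W {i \<in> {..<n}. f i a = b}"
      unfolding pmf_map by (rule measure_prob_cong_0) (auto simp: W v_def)
    also have "\<dots> = (\<Sum>i\<in>{i \<in> {..<n}. f i a = b}. w i)"
      by (subst measure_measure_pmf_finite) (auto simp: W v_def)
    also have "\<dots> = (\<Sum>i<n. if f i a = b then w i else 0)"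
      by (subst sum.inter_filter) auto
    also have "\<dots> = pmf (M a) b"
    proof (cases "b \<in> B")
      case True
      then show ?thesis using eq a by simp
    next
      case False
      then have "pmf (M a) b = 0" using supp[OF a] by (auto simp: set_pmf_iff)
      moreover have "(\<Sum>i<n. if f i a = b then w i else 0) = 0"
        using fB[OF _ a] False by (intro sum.neutral) auto
      ultimately show ?thesis by simp
    qed
    finally show "pmf (M a) b = pmf (map_pmf (\<lambda>i. f i a) W) b" by simp
  qed
  then show ?thesis using fin_W supp_W inj by blast
qed

section \<open>Conditional distributions\<close>

lemma set_cond_dist:
  assumes "b \<in> set_pmf (map_pmf g p)"
  shows "set_pmf (cond_dist p f g b) = f ` {w \<in> set_pmf p. g w = b}"
proof -
  have "set_pmf p \<inter> {w. g w = b} \<noteq> {}" using assms by auto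
  then show ?thesis by (auto simp: cond_dist_def set_cond_pmf)
qed

text \<open>The chain rule; it reduces consistency of the constructed \<open>Q\<close> to matching
  the conditional laws of \<open>Y\<close> given \<open>X\<close>.\<close>

lemma bind_cond_dist_snd_fst:
  fixes P :: "('a \<times> 'b) pmf"
  assumes "finite (set_pmf P)"
  shows "bind_pmf (map_pmf fst P) (\<lambda>x. map_pmf (Pair x) (cond_dist P snd fst x)) = P"
proof (rule pmf_eqI)
  fix u :: "'a \<times> 'b"
  obtain x y where u: "u = (x, y)" by (cases u)
  let ?X = "set_pmf (map_pmf fst P)"
  have fin: "finite ?X" using assms by simp
  \<comment> \<open>\<open>Pair x'\<close> fixes the first component, so only \<open>x' = x\<close>
    contributes; there the marginal cancels the denominator of the conditional probability.\<close>
  have term_eq: "pmf (map_pmf (Pair x') (cond_dist P snd fst x')) (x, y) * pmf (map_pmf fst P) x' =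
      (if x' = x then pmf P (x, y) else 0)" if "x' \<in> ?X" for x'
  proof (cases "x' = x")
    case True
    have "pmf (map_pmf (Pair x) (cond_dist P snd fst x)) (x, y) = pmf (cond_dist P snd fst x) y"
      by (rule pmf_map_inj') (simp add: inj_def)
    moreover have "pmf (map_pmf fst P) x \<noteq> 0" using pmf_positive[OF that] True by simp
    ultimately show ?thesis
      using True that pmf_cond_dist_snd_fst[of x P y] by simp
  next
    case False
    then have "(x, y) \<notin> set_pmf (map_pmf (Pair x') (cond_dist P snd fst x'))" by auto
    then show ?thesis using False by (simp add: set_pmf_iff del: set_map_pmf)
  qed
  have "pmf (bind_pmf (map_pmf fst P) (\<lambda>x. map_pmf (Pair x) (cond_dist P snd fst x))) u =
      (\<Sum>x'\<in>?X. pmf (map_pmf (Pair x') (cond_dist P snd fst x')) (x, y) * pmf (map_pmf fst P) x')"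
    unfolding pmf_bind u by (rule integral_measure_pmf_real[OF fin]) auto
  also have "\<dots> = (\<Sum>x'\<in>?X. if x' = x then pmf P (x, y) else 0)"
    by (rule sum.cong[OF refl term_eq])
  also have "\<dots> = (if x \<in> ?X then pmf P (x, y) else 0)" using fin by simp
  also have "\<dots> = pmf P u"
    using u by (force simp: set_pmf_iff image_iff)
  finally show "pmf (bind_pmf (map_pmf fst P) (\<lambda>x. map_pmf (Pair x) (cond_dist P snd fst x))) u = pmf P u" .
qed

section \<open>Necessity and sufficiency\<close>

text \<open>The alphabet of \<open>Z\<close> is left arbitrary, so that both the forward direction
  over \<open>nat\<close> and the claim for \<open>'z\<close> follow from it.\<close>

lemma secret_encoding_bound:
  fixes Q :: "('x \<times> 'y \<times> 'z) pmf"
  assumes Q: "secret_encoding P Q"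
  shows "(\<Sum>x \<in> set_pmf (map_pmf fst P). pmf (cond_dist P snd fst x) y) \<le> 1"
proof -
  let ?X = "set_pmf (map_pmf fst P)"
  let ?QZ = "map_pmf (\<lambda>(x, y, z). z) Q"
  let ?Z = "set_pmf ?QZ"
  have finQ: "finite (set_pmf Q)" and cons: "map_pmf (\<lambda>(x, y, z). (x, y)) Q = P"
    and inf: "informative Q" and sec: "perfectly_secret P Q"
    using Q by (auto simp: secret_encoding_def consistent_def)
  have finZ: "finite ?Z" using finQ by simp
  have "finite (set_pmf P)" using finQ cons by (metis finite_imageI set_map_pmf)
  then have finX: "finite ?X" by simp
  have P_eq: "pmf P (x, y) = (\<Sum>z\<in>?Z. pmf Q (x, y, z))" for x
  proof -
    have "pmf P (x, y) = measure_pmf.prob Q ((\<lambda>z. (x, y, z)) ` ?Z)"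
      unfolding cons[symmetric] pmf_map
      by (rule measure_prob_cong_0) (force simp: set_pmf_iff image_iff)+
    also have "\<dots> = (\<Sum>z\<in>?Z. pmf Q (x, y, z))"
      using finZ by (subst measure_measure_pmf_finite) (auto simp: sum.reindex inj_on_def)
    finally show ?thesis .
  qed
  \<comment> \<open>Secrecy turns the product on the right into the probability of
    \<open>(x, z)\<close> under \<open>Q\<close>, which dominates that of
    \<open>(x, y, z)\<close>.\<close>
  have le: "pmf Q (x, y, z) \<le> pmf (map_pmf fst P) x * pmf ?QZ z" if z: "z \<in> ?Z" for x z
  proof -
    have "pmf (map_pmf fst P) x = pmf (cond_dist Q (\<lambda>(x, y, z). x) (\<lambda>(x, y, z). z) z) x"
      using sec z unfolding perfectly_secret_def by metis
    also have "\<dots> = pmf (map_pmf (\<lambda>w. ((\<lambda>(x, y, z). x) w, (\<lambda>(x, y, z). z) w)) Q) (x, z) / pmf ?QZ z"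
      by (rule pmf_cond_dist[OF z])
    finally have "pmf (map_pmf fst P) x * pmf ?QZ z =
        pmf (map_pmf (\<lambda>w. ((\<lambda>(x, y, z). x) w, (\<lambda>(x, y, z). z) w)) Q) (x, z)"
      using pmf_positive[OF z] by simp
    moreover have "pmf Q (x, y, z) \<le> \<dots>"
      unfolding pmf_map measure_pmf_single[of Q, symmetric]
      by (rule measure_pmf.finite_measure_mono) auto
    ultimately show ?thesis by simp
  qed
  \<comment> \<open>Both values lie in the support of the same conditional law, which
    informativeness makes a singleton.\<close>
  have unique: "x = x'" if "(x, y, z) \<in> set_pmf Q" "(x', y, z) \<in> set_pmf Q" for x x' z
  proof -
    have yz: "(y, z) \<in> set_pmf (map_pmf (\<lambda>(x, y, z). (y, z)) Q)" using that by force
    then obtain x0 where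
      "cond_dist Q (\<lambda>(x, y, z). x) (\<lambda>(x, y, z). (y, z)) (y, z) = return_pmf x0"
      using inf unfolding informative_def by blast
    then have single: "(\<lambda>(x, y, z). x) ` {w \<in> set_pmf Q. (\<lambda>(x, y, z). (y, z)) w = (y, z)} = {x0}"
      using set_cond_dist[OF yz, of "\<lambda>(x, y, z). x"] by simp
    have "u = x0" if "(u, y, z) \<in> set_pmf Q" for u
    proof -
      have "u \<in> (\<lambda>(x, y, z). x) ` {w \<in> set_pmf Q. (\<lambda>(x, y, z). (y, z)) w = (y, z)}"
        using that by (intro image_eqI[of _ _ "(u, y, z)"]) auto
      then show ?thesis unfolding single by simp
    qed
    then show ?thesis using that by metis
  qed
  have slice: "(\<Sum>x\<in>?X. pmf Q (x, y, z) / pmf (map_pmf fst P) x) \<le> pmf ?QZ z"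
    if z: "z \<in> ?Z" for z
  proof (cases "\<exists>x\<in>?X. (x, y, z) \<in> set_pmf Q")
    case False
    then have "(\<Sum>x\<in>?X. pmf Q (x, y, z) / pmf (map_pmf fst P) x) = 0"
      by (intro sum.neutral) (auto simp: set_pmf_iff)
    then show ?thesis by simp
  next
    case True
    then obtain x where x: "x \<in> ?X" "(x, y, z) \<in> set_pmf Q" by blast
    \<comment> \<open>By \<open>unique\<close> only one term of the slice survives, and
      \<open>le\<close> divided by the marginal of \<open>x\<close> bounds it.\<close>
    have "pmf Q (x', y, z) = 0" if "x' \<noteq> x" for x'
      using unique[OF x(2)] that by (auto simp: set_pmf_iff)
    then have "(\<Sum>x\<in>?X. pmf Q (x, y, z) / pmf (map_pmf fst P) x) =
        (\<Sum>x\<in>{x}. pmf Q (x, y, z) / pmf (map_pmf fst P) x)"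
      using x(1) finX by (intro sum.mono_neutral_right) auto
    also have "\<dots> \<le> pmf ?QZ z"
      using le[OF z, of x] pmf_positive[OF x(1)] by (simp add: field_simps)
    finally show ?thesis .
  qed
  have "(\<Sum>x\<in>?X. pmf (cond_dist P snd fst x) y) = (\<Sum>x\<in>?X. pmf P (x, y) / pmf (map_pmf fst P) x)"
    by (intro sum.cong refl pmf_cond_dist_snd_fst)
  also have "\<dots> = (\<Sum>x\<in>?X. \<Sum>z\<in>?Z. pmf Q (x, y, z) / pmf (map_pmf fst P) x)"
    by (simp only: P_eq sum_divide_distrib)
  also have "\<dots> = (\<Sum>z\<in>?Z. \<Sum>x\<in>?X. pmf Q (x, y, z) / pmf (map_pmf fst P) x)"
    by (rule sum.swap)
  also have "\<dots> \<le> (\<Sum>z\<in>?Z. pmf ?QZ z)"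
    by (intro sum_mono slice)
  also have "\<dots> = 1"
    using finZ by (intro sum_pmf_eq_1) auto
  finally show ?thesis .
qed

text \<open>The alphabet \<open>nat\<close> suffices because \<open>Z\<close> is the index of an
  injection in a finite mixture.\<close>

lemma secret_encoding_exists:
  fixes P :: "('x \<times> 'y) pmf"
  assumes fin: "finite (set_pmf P)"
    and bound: "\<forall>y \<in> set_pmf (map_pmf snd P).
      (\<Sum>x \<in> set_pmf (map_pmf fst P). pmf (cond_dist P snd fst x) y) \<le> 1"
  shows "\<exists>Q :: ('x \<times> 'y \<times> nat) pmf. secret_encoding P Q"
proof -
  let ?PX = "map_pmf fst P"
  let ?X = "set_pmf ?PX"
  have "set_pmf (cond_dist P snd fst x) \<subseteq> set_pmf (map_pmf snd P)" if "x \<in> ?X" for x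
    using that by (subst set_cond_dist) auto
  then have "\<exists>(W :: nat pmf) f. finite (set_pmf W) \<and> (\<forall>i\<in>set_pmf W. inj_on (f i) ?X) \<and>
      (\<forall>x\<in>?X. cond_dist P snd fst x = map_pmf (\<lambda>i. f i x) W)"
    using fin bound
    by (intro pmf_mixture_of_injections[where B = "set_pmf (map_pmf snd P)"] set_pmf_not_empty)
      (simp_all del: set_map_pmf, simp_all)
  then obtain W :: "nat pmf" and f where finW: "finite (set_pmf W)"
    and inj': "\<forall>i\<in>set_pmf W. inj_on (f i) ?X"
    and cond': "\<forall>x\<in>?X. cond_dist P snd fst x = map_pmf (\<lambda>i. f i x) W"
    by blast
  have inj: "inj_on (f i) ?X" if "i \<in> set_pmf W" for i
    using inj' that by blast
  have cond: "cond_dist P snd fst x = map_pmf (\<lambda>i. f i x) W" if "x \<in> ?X" for x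
    using cond' that by blast
  define Q where "Q = map_pmf (\<lambda>(x, i). (x, f i x, i)) (pair_pmf ?PX W)"
  have set_Q: "set_pmf Q = (\<lambda>(x, i). (x, f i x, i)) ` (?X \<times> set_pmf W)"
    by (simp add: Q_def)
  \<comment> \<open>Unfolding the independent pair into a bind over \<open>X\<close> brings it into
    the shape of the chain rule.\<close>
  have "map_pmf (\<lambda>(x, y, z). (x, y)) Q =
      bind_pmf ?PX (\<lambda>x. map_pmf (Pair x) (map_pmf (\<lambda>i. f i x) W))"
    by (simp add: Q_def pair_pmf_def map_pmf_def bind_assoc_pmf bind_return_pmf)
  also have "\<dots> = bind_pmf ?PX (\<lambda>x. map_pmf (Pair x) (cond_dist P snd fst x))"
    by (intro bind_pmf_cong refl) (simp only: cond)
  finally have "consistent P Q"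
    using bind_cond_dist_snd_fst[OF fin] by (simp add: consistent_def)
  moreover have "informative Q"
    unfolding informative_def
  proof safe
    fix y z
    assume yz: "(y, z) \<in> set_pmf (map_pmf (\<lambda>(x, y, z). (y, z)) Q)"
    then have "(y, z) \<in> (\<lambda>u. (f (snd u) (fst u), snd u)) ` (?X \<times> set_pmf W)"
      by (simp only: set_map_pmf[of _ Q] set_Q image_image case_prod_beta fst_conv snd_conv)
    then obtain x where x: "x \<in> ?X" "z \<in> set_pmf W" "y = f z x"
      by (auto simp del: set_map_pmf)
    \<comment> \<open>Given \<open>z\<close>, the value \<open>y = f z x\<close> determines
      \<open>x\<close>, since \<open>f z\<close> is injective on the support of
      \<open>X\<close>.\<close>
    have "set_pmf (cond_dist Q (\<lambda>(x, y, z). x) (\<lambda>(x, y, z). (y, z)) (y, z)) \<subseteq> {x}"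
      unfolding set_cond_dist[OF yz] set_Q using x inj[OF x(2)]
      by (auto simp: inj_on_eq_iff simp del: set_map_pmf)
    then show "\<exists>x. cond_dist Q (\<lambda>(x, y, z). x) (\<lambda>(x, y, z). (y, z)) (y, z) = return_pmf x"
      by (auto simp: set_pmf_subset_singleton)
  qed
  moreover have "perfectly_secret P Q"
    unfolding perfectly_secret_def
  proof
    fix z assume z: "z \<in> set_pmf (map_pmf (\<lambda>(x, y, z). z) Q)"
    \<comment> \<open>Dropping \<open>Y\<close> recovers the independent pair, so conditioning on
      \<open>z\<close> merely cancels \<open>pmf W z\<close>.\<close>
    have QXZ: "map_pmf (\<lambda>w. ((\<lambda>(x, y, z). x) w, (\<lambda>(x, y, z). z) w)) Q = pair_pmf ?PX W"
      by (simp add: Q_def pmf.map_comp o_def case_prod_beta)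
    have "map_pmf (\<lambda>(x, y, z). z) Q = map_pmf snd (pair_pmf ?PX W)"
      by (simp add: Q_def pmf.map_comp o_def case_prod_beta)
    then have QZ: "map_pmf (\<lambda>(x, y, z). z) Q = W" by (simp add: map_snd_pair_pmf)
    show "cond_dist Q (\<lambda>(x, y, z). x) (\<lambda>(x, y, z). z) z = ?PX"
    proof (rule pmf_eqI)
      fix x
      have "pmf W z \<noteq> 0" using z QZ by (simp add: set_pmf_iff)
      then show "pmf (cond_dist Q (\<lambda>(x, y, z). x) (\<lambda>(x, y, z). z) z) x = pmf ?PX x"
        unfolding pmf_cond_dist[OF z] QXZ QZ pmf_pair by simp
    qed
  qed
  moreover have "finite (set_pmf Q)" using fin finW by (simp add: set_Q)
  ultimately show ?thesis by (auto simp: secret_encoding_def)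
qed

theorem theorem1:
  fixes P :: "('x \<times> 'y) pmf"
  assumes "finite (set_pmf P)"
  shows "((\<exists>Q :: ('x \<times> 'y \<times> nat) pmf. secret_encoding P Q) \<longleftrightarrow>
            (\<forall>y \<in> set_pmf (map_pmf snd P).
               (\<Sum>x \<in> set_pmf (map_pmf fst P). pmf (cond_dist P snd fst x) y) \<le> 1)) \<and>
         ((\<exists>Q :: ('x \<times> 'y \<times> 'z) pmf. secret_encoding P Q) \<longrightarrow>
            (\<forall>y \<in> set_pmf (map_pmf snd P).
               (\<Sum>x \<in> set_pmf (map_pmf fst P). pmf (cond_dist P snd fst x) y) \<le> 1))"
  by (intro conjI iffI impI secret_encoding_exists[OF assms])
    (auto dest!: secret_encoding_bound simp del: set_map_pmf)

end
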